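(* Let $\delta\in(0,1]$, $\rho\in[1,2)$, and let $X_\delta=\omega_\delta-\omega=(X_\delta^1,\dots,X_\delta^m)$. The variance of any of the components $X_\delta^i$ satisfies $$\sigma^2_{X_\delta^i}(u)\le\delta^{1-1/\rho}u^{1/\rho}\qquad\text{for all }u\ge0.$$ As a result, for all $s\le t$, $$\|R_{X_\delta^i}\|_{\rho,[s,t]^2}\le\delta^{1-1/\rho}M|t-s|^{1/\rho},\qquad M:=\Big(\frac{2^{1+\rho}+1}{3^{1-\rho}}\Big)^{1/\rho}.$$
   Context: $\omega$ is the canonical two-sided Brownian motion in $\mathbb{R}^m$ (independent components, $\omega(0)=0$), and for $\delta\in(0,1]$, $\omega_\delta(t)=\frac1\delta\int_0^t(\omega(\delta+r)-\omega(r))\,dr$, $t\in\mathbb{R}$. The process $X_\delta$ is centered Gaussian with stationary increments. For a real process $X$ with stationary increments, $\sigma_X^2(u)=\mathbb{E}(X(t+u)-X(t))^2$, $u\ge0$ (independent of $t\in\mathbb{R}$). For a real square-integrable process $X$ the $\rho$-variation of its incremental covariance over $[s,t]^2$ is $$\|R_X\|_{\rho,[s,t]^2}=\Big(\sup_{\mathcal{P},\mathcal{P}'}\sum_{[\sigma,\tau]\in\mathcal{P},\,[\sigma',\tau']\in\mathcal{P}'}\big|\mathbb{E}(X(\tau)-X(\sigma))(X(\tau')-X(\sigma'))\big|^\rho\Big)^{1/\rho},$$ the supremum being over all pairs of partitions $\mathcal{P},\mathcal{P}'$ of $[s,t]$. *)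

theory Defs
  imports "HOL-Probability.Probability"
begin

definition real_brownian_motion :: "'a measure \<Rightarrow> (real \<Rightarrow> 'a \<Rightarrow> real) \<Rightarrow> bool" where
  "real_brownian_motion M B \<longleftrightarrow>
     prob_space M \<and>
     (\<forall>t. B t \<in> borel_measurable M) \<and>
     (\<forall>x\<in>space M. B 0 x = 0 \<and> continuous_on UNIV (\<lambda>t. B t x)) \<and>
     (\<forall>s t. s < t \<longrightarrow>
        distributed M lborel (\<lambda>x. B t x - B s x) (\<lambda>y. ennreal (normal_density 0 (sqrt (t - s)) y))) \<and>
     (\<forall>(n::nat) \<tau>. (\<forall>k<n. \<tau> k < \<tau> (Suc k)) \<longrightarrow>
        prob_space.indep_vars M (\<lambda>_. borel) (\<lambda>k x. B (\<tau> (Suc k)) x - B (\<tau> k) x) {..<n})"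

text \<open>The time set is all of \<open>\<real>\<close>, so the processes are two-sided. The components
  are required to be independent as processes, i.e. as random elements of the product space of
  all functions of time.\<close>

definition brownian_motion :: "'a measure \<Rightarrow> (real \<Rightarrow> 'a \<Rightarrow> real ^ 'm) \<Rightarrow> bool" where
  "brownian_motion M W \<longleftrightarrow>
     prob_space M \<and>
     (\<forall>i. real_brownian_motion M (\<lambda>t x. W t x $ i)) \<and>
     prob_space.indep_vars M (\<lambda>_::'m. PiM UNIV (\<lambda>_::real. borel)) (\<lambda>i x t. W t x $ i) UNIV"

text \<open>The canonical path space carries the \<open>\<sigma>\<close>-algebra generated by the evaluation maps,
  which on continuous paths is the Borel \<open>\<sigma>\<close>-algebra of the compact-open topology.
  A measure is the two-sided Wiener measure iff the evaluation maps form a Brownian motion.\<close>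

definition wiener_measure :: "(real \<Rightarrow> real ^ 'm) measure \<Rightarrow> bool" where
  "wiener_measure P \<longleftrightarrow>
     sets P = sets (restrict_space (PiM UNIV (\<lambda>_::real. borel))
                      {\<omega>. continuous_on UNIV \<omega> \<and> \<omega> 0 = 0}) \<and>
     brownian_motion P (\<lambda>t \<omega>. \<omega> t)"

text \<open>For \<open>t < 0\<close> the interval integral is oriented: the integral from \<open>0\<close> to \<open>t\<close>
  is minus the integral from \<open>t\<close> to \<open>0\<close>.\<close>

definition smoothed_path :: "real \<Rightarrow> (real \<Rightarrow> real ^ 'm) \<Rightarrow> real \<Rightarrow> real ^ 'm" where
  "smoothed_path \<delta> \<omega> t = (1 / \<delta>) *\<^sub>R (LBINT r=0..t. \<omega> (\<delta> + r) - \<omega> r)"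

definition smoothing_error :: "real \<Rightarrow> real \<Rightarrow> (real \<Rightarrow> real ^ 'm) \<Rightarrow> real ^ 'm" where
  "smoothing_error \<delta> t \<omega> = smoothed_path \<delta> \<omega> t - \<omega> t"

text \<open>For processes with stationary increments this does not depend on the base point \<open>t\<close>.\<close>

definition increment_variance :: "'a measure \<Rightarrow> (real \<Rightarrow> 'a \<Rightarrow> real) \<Rightarrow> real \<Rightarrow> real \<Rightarrow> real" where
  "increment_variance M X t u = (\<integral>x. (X (t + u) x - X t x)\<^sup>2 \<partial>M)"

definition increment_covariance ::
    "'a measure \<Rightarrow> (real \<Rightarrow> 'a \<Rightarrow> real) \<Rightarrow> real set \<Rightarrow> real set \<Rightarrow> real" where
  "increment_covariance M X I J =
     (\<integral>x. (X (Sup I) x - X (Inf I) x) * (X (Sup J) x - X (Inf J) x) \<partial>M)"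

text \<open>The supremum is taken in the extended nonnegative reals, so that an unbounded family
  of sums gives infinite variation. Divisions may contain singletons; these contribute zero
  increments and do not affect the supremum.\<close>

definition covariance_variation ::
    "real \<Rightarrow> 'a measure \<Rightarrow> (real \<Rightarrow> 'a \<Rightarrow> real) \<Rightarrow> real \<Rightarrow> real \<Rightarrow> ennreal" where
  "covariance_variation \<rho> M X s t =
     (let S = (SUP (\<P>, \<P>') \<in> {\<P>. \<P> division_of {s..t}} \<times> {\<P>. \<P> division_of {s..t}}.
                 ennreal (\<Sum>I\<in>\<P>. \<Sum>J\<in>\<P>'. \<bar>increment_covariance M X I J\<bar> powr \<rho>))
      in if S = \<top> then \<top> else ennreal (enn2real S powr (1 / \<rho>)))"

end

theory Submission
  imports Defs
begin

text \<open>
  An increment of \<open>X\<^sub>\<delta>\<close> is the average over \<open>r \<in> [0, \<delta>]\<close> of second order Brownian increments, so by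
  Fubini its variance is the double integral of their covariance. With \<open>p = max 0 (\<delta> - u)\<close> it
  equals \<open>2 \<delta> / 3 - p\<^sup>2 / \<delta> + p\<^sup>3 / (3 \<delta>\<^sup>2)\<close>, which is a nondecreasing concave function of \<open>u \<ge> 0\<close>
  bounded by both \<open>u\<close> and \<open>\<delta>\<close>; interpolating these two bounds gives the first claim.

  For a fixed interval \<open>I\<close>, monotonicity and concavity of the variance show that the covariance of the
  increment over \<open>I\<close> with the increment up to \<open>v\<close> is monotone in \<open>v\<close> to the left of, inside and to
  the right of \<open>I\<close>, with total variation at most twice the variance over \<open>I\<close>. Since \<open>\<rho> \<ge> 1\<close>, each inner
  sum of \<open>\<rho>\<close>-th powers is at most the \<open>\<rho>\<close>-th power of this, and summing over \<open>I\<close> gives the second claim,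
  with the constant \<open>2 \<le> M\<close>.
\<close>

section \<open>Calculus of the explicit variance function\<close>

text \<open>At 0 the difference quotient is bounded by \<open>max 0 h ^ Suc n\<close>, so the kink
  of the positive part disappears from the second power on. This permits differentiation across
  \<open>u = \<delta>\<close> without case distinctions.\<close>

lemma has_field_derivative_max_0_power:
  fixes x :: real
  shows "((\<lambda>x. max 0 x ^ Suc (Suc n)) has_field_derivative real (Suc (Suc n)) * max 0 x ^ Suc n) (at x)"
proof -
  consider "x < 0" | "x = 0" | "0 < x" by linarith
  then show ?thesis
  proof cases
    case 1
    have "((\<lambda>_. 0::real) has_field_derivative 0) (at x)" by simp
    then have "((\<lambda>x. max 0 x ^ Suc (Suc n)) has_field_derivative 0) (at x)"
      by (rule has_field_derivative_transform_within_open[where S = "{..<0}"]) (use 1 in auto)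
    then show ?thesis using 1 by simp
  next
    case 2
    have "((\<lambda>h. max 0 h ^ Suc (Suc n) / h) \<longlongrightarrow> 0) (at (0::real))"
    proof (rule Lim_null_comparison)
      show "\<forall>\<^sub>F h in at (0::real). norm (max 0 h ^ Suc (Suc n) / h) \<le> max 0 h ^ Suc n"
        by (auto simp: eventually_at_filter max_def intro!: always_eventually)
      have "((\<lambda>h. max 0 h ^ Suc n) \<longlongrightarrow> max 0 0 ^ Suc n) (at (0::real))"
        by (intro tendsto_intros)
      then show "((\<lambda>h. max 0 h ^ Suc n) \<longlongrightarrow> 0) (at (0::real))" by simp
    qed
    then show ?thesis using 2 unfolding has_field_derivative_iff by simp
  next
    case 3
    have "((\<lambda>x. x ^ Suc (Suc n)) has_field_derivative real (Suc (Suc n)) * x ^ Suc n) (at x)"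
      by (rule DERIV_cong[OF DERIV_pow]) simp
    then have "((\<lambda>x. max 0 x ^ Suc (Suc n)) has_field_derivative real (Suc (Suc n)) * x ^ Suc n) (at x)"
      by (rule has_field_derivative_transform_within_open[where S = "{0<..}"]) (use 3 in auto)
    then show ?thesis using 3 by simp
  qed
qed

text \<open>Equals \<open>u - u ^ 3 / (3 * \<delta>\<^sup>2)\<close> for
  \<open>u \<le> \<delta>\<close> and \<open>2 * \<delta> / 3\<close> beyond; the positive part
  joins both branches in one continuously differentiable formula.\<close>

definition smoothing_variance :: "real \<Rightarrow> real \<Rightarrow> real" where
  "smoothing_variance \<delta> u =
     2 * \<delta> / 3 - max 0 (\<delta> - u) ^ 2 / \<delta> + max 0 (\<delta> - u) ^ 3 / (3 * \<delta>\<^sup>2)"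

lemma smoothing_variance_0: "0 < \<delta> \<Longrightarrow> smoothing_variance \<delta> 0 = 0"
  by (simp add: smoothing_variance_def field_simps power2_eq_square power3_eq_cube)

lemma has_field_derivative_smoothing_variance:
  assumes "0 < \<delta>"
  shows "(smoothing_variance \<delta> has_field_derivative
           2 * max 0 (\<delta> - u) / \<delta> - (max 0 (\<delta> - u))\<^sup>2 / \<delta>\<^sup>2) (at u)"
proof -
  have *: "((\<lambda>u. max 0 (\<delta> - u) ^ Suc (Suc n)) has_field_derivative
      - (real (Suc (Suc n)) * max 0 (\<delta> - u) ^ Suc n)) (at u)" for n
    by (rule DERIV_cong[OF DERIV_chain2[OF has_field_derivative_max_0_power]])
       (auto intro!: derivative_eq_intros)
  note d2 = *[of 0, unfolded numeral_2_eq_2[symmetric]]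
  note d3 = *[of 1, unfolded One_nat_def numeral_3_eq_3[symmetric]]
  show ?thesis
    unfolding smoothing_variance_def
    by (rule DERIV_cong[OF DERIV_add[OF DERIV_diff[OF DERIV_const DERIV_cdivide[OF d2]]
            DERIV_cdivide[OF d3]]])
       (use assms in \<open>simp add: field_simps power2_eq_square\<close>)
qed

lemma smoothing_variance_mono:
  assumes "0 < \<delta>" "0 \<le> x" "x \<le> y"
  shows "smoothing_variance \<delta> x \<le> smoothing_variance \<delta> y"
proof (rule DERIV_nonneg_imp_nondecreasing[OF assms(3)])
  fix z assume z: "x \<le> z" "z \<le> y"
  define p where "p = max 0 (\<delta> - z)"
  have "0 \<le> p" "p \<le> \<delta>" using z assms by (auto simp: p_def)
  then have "p * p \<le> 2 * p * \<delta>" by (intro mult_mono[of p "2*p" p \<delta>]) auto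
  then have "0 \<le> 2 * p / \<delta> - p\<^sup>2 / \<delta>\<^sup>2"
    using assms by (simp add: field_simps power2_eq_square)
  then show "\<exists>w. (smoothing_variance \<delta> has_real_derivative w) (at z) \<and> 0 \<le> w"
    using has_field_derivative_smoothing_variance[OF assms(1), of z] by (auto simp: p_def)
qed

text \<open>The derivative is nonincreasing on the half-line. This form of concavity is the
  hypothesis \<open>incr\<close> of \<open>sum_polar_covariance_le\<close>.\<close>

lemma smoothing_variance_increment_antimono:
  assumes "0 < \<delta>" "0 \<le> x" "x \<le> y" "0 \<le> a"
  shows "smoothing_variance \<delta> (y + a) - smoothing_variance \<delta> y
       \<le> smoothing_variance \<delta> (x + a) - smoothing_variance \<delta> x"
proof -
  let ?d = "\<lambda>z. 2 * max 0 (\<delta> - z) / \<delta> - (max 0 (\<delta> - z))\<^sup>2 / \<delta>\<^sup>2"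
  show ?thesis
  proof (rule DERIV_nonpos_imp_nonincreasing[OF assms(3),
        where f = "\<lambda>z. smoothing_variance \<delta> (z + a) - smoothing_variance \<delta> z"])
    fix z assume z: "x \<le> z" "z \<le> y"
    \<comment> \<open>After scaling by \<open>\<delta>\<close> the derivative reads
      \<open>1 - (1 - p)\<^sup>2\<close>, which increases in \<open>p\<close> as long as
      \<open>p \<le> 1\<close>; \<open>0 \<le> z\<close> ensures the latter.\<close>
    define p where "p = max 0 (\<delta> - z) / \<delta>"
    define q where "q = max 0 (\<delta> - (z + a)) / \<delta>"
    have "p \<le> 1" "q \<le> p" using z assms by (auto simp: p_def q_def divide_simps)
    then have "(1 - p)\<^sup>2 \<le> (1 - q)\<^sup>2" by (intro power_mono) auto
    then have "(2 * q - q\<^sup>2) - (2 * p - p\<^sup>2) \<le> 0"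
      by (simp add: power2_eq_square algebra_simps)
    then have "?d (z + a) - ?d z \<le> 0" by (simp add: p_def q_def power_divide)
    moreover have "((\<lambda>z. smoothing_variance \<delta> (z + a) - smoothing_variance \<delta> z)
        has_real_derivative ?d (z + a) - ?d z) (at z)"
      using has_field_derivative_smoothing_variance[OF assms(1), of z]
        has_field_derivative_smoothing_variance[OF assms(1), of "z + a"]
      by (auto intro!: DERIV_diff simp: DERIV_shift)
    ultimately show "\<exists>w. ((\<lambda>z. smoothing_variance \<delta> (z + a) - smoothing_variance \<delta> z)
        has_real_derivative w) (at z) \<and> w \<le> 0" by blast
  qed
qed

lemma smoothing_variance_le:
  assumes "0 < \<delta>" "0 \<le> u"
  shows "smoothing_variance \<delta> u \<le> u" "smoothing_variance \<delta> u \<le> \<delta>"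
proof -
  define p where "p = max 0 (\<delta> - u)"
  have p: "0 \<le> p" "p \<le> \<delta>" using assms by (auto simp: p_def)
  have v: "smoothing_variance \<delta> u = (2 * \<delta>^3 - 3 * \<delta> * p^2 + p^3) / (3 * \<delta>\<^sup>2)"
    using assms by (simp add: smoothing_variance_def p_def field_simps power2_eq_square power3_eq_cube)
  have "p * p\<^sup>2 \<le> \<delta> * p\<^sup>2" "0 \<le> \<delta> * p\<^sup>2" "0 \<le> \<delta>^3"
    using p by (auto intro!: mult_right_mono)
  then have "2 * \<delta>^3 - 3 * \<delta> * p^2 + p^3 \<le> \<delta> * (3 * \<delta>\<^sup>2)"
    by (simp add: power2_eq_square power3_eq_cube)
  then show "smoothing_variance \<delta> u \<le> \<delta>" using assms by (simp add: v divide_le_eq)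
  \<comment> \<open>The two sides of the next inequality differ by exactly this cube, and
    \<open>\<delta> - p\<close> is the minimum of \<open>\<delta>\<close> and
    \<open>u\<close>.\<close>
  have "0 \<le> (\<delta> - p)^3" using p by simp
  then have "2 * \<delta>^3 - 3 * \<delta> * p^2 + p^3 \<le> (\<delta> - p) * (3 * \<delta>\<^sup>2)"
    by (simp add: power2_eq_square power3_eq_cube algebra_simps)
  then have "smoothing_variance \<delta> u \<le> \<delta> - p" using assms by (simp add: v divide_le_eq)
  also have "\<dots> \<le> u" by (simp add: p_def)
  finally show "smoothing_variance \<delta> u \<le> u" .
qed

lemma smoothing_variance_nonneg:
  assumes "0 < \<delta>" "0 \<le> u"
  shows "0 \<le> smoothing_variance \<delta> u"
  using smoothing_variance_mono[of \<delta> 0 u] assms by (simp add: smoothing_variance_0)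

section \<open>Two inequalities for real powers\<close>

text \<open>Weighted geometric mean of two upper bounds; applied with \<open>a = \<delta>\<close>,
  \<open>b = u\<close> and \<open>\<theta> = 1 / \<rho>\<close>.\<close>

lemma le_powr_interpolate:
  fixes x a b \<theta> :: real
  assumes "0 \<le> x" "x \<le> a" "x \<le> b" "0 \<le> \<theta>" "\<theta> \<le> 1"
  shows "x \<le> a powr (1 - \<theta>) * b powr \<theta>"
proof -
  have "x = x powr (1 - \<theta>) * x powr \<theta>"
    using assms by (simp flip: powr_add)
  also have "\<dots> \<le> a powr (1 - \<theta>) * b powr \<theta>"
    using assms by (intro mult_mono powr_mono2) auto
  finally show ?thesis .
qed

text \<open>In \<open>y powr r = y * y powr (r - 1)\<close> the first factor is kept and the base of
  the second is enlarged to the whole sum, which \<open>1 \<le> r\<close> allows.\<close>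

lemma sum_powr_le_powr_sum:
  fixes f :: "'b \<Rightarrow> real"
  assumes "finite A" "\<And>x. x \<in> A \<Longrightarrow> 0 \<le> f x" "1 \<le> r"
  shows "(\<Sum>x\<in>A. f x powr r) \<le> (\<Sum>x\<in>A. f x) powr r"
proof -
  have pw: "y powr r = y * y powr (r - 1)" if "0 \<le> y" for y :: real
    using that assms(3) by (cases "y = 0") (simp_all add: powr_diff)
  have "(\<Sum>x\<in>A. f x powr r) \<le> (\<Sum>x\<in>A. f x * sum f A powr (r - 1))"
    using assms
    by (intro sum_mono) (auto simp: pw intro!: mult_left_mono powr_mono2 member_le_sum)
  also have "\<dots> = sum f A powr r"
    using assms by (simp add: pw sum_nonneg sum_distrib_right)
  finally show ?thesis .
qed

section \<open>Divisions and the total variation of covariances\<close>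

text \<open>Telescoping without sorting the division: increments add up when an interval is cut in
  two, which is what \<open>operative_real\<close> asks for.\<close>

lemma sum_division_of_increments:
  fixes h :: "real \<Rightarrow> 'b::ab_group_add"
  assumes "s \<le> t" "\<P> division_of {s..t}"
  shows "(\<Sum>I\<in>\<P>. h (Sup I) - h (Inf I)) = h t - h s"
proof -
  \<comment> \<open>Additivity requires the value 0 on the empty set, where \<open>Sup\<close> and
    \<open>Inf\<close> would give something arbitrary; members of a division are nonempty, so the
    sum does not change.\<close>
  let ?g = "\<lambda>I::real set. if I = {} then 0 else h (Sup I) - h (Inf I)"
  interpret operative_real plus 0 ?g
    by standard (auto simp: min_def)
  have "sum ?g \<P> = ?g {s..t}"
    using division[of \<P> s t, folded sum_def] assms by simp
  moreover have "sum ?g \<P> = (\<Sum>I\<in>\<P>. h (Sup I) - h (Inf I))"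
    using assms by (intro sum.cong) (auto dest: division_ofD(3))
  ultimately show ?thesis using assms by simp
qed

text \<open>The covariance of the increments over \<open>{p..q}\<close> and \<open>{u..v}\<close> of a process whose increments
  have variance function \<open>\<sigma>\<close>, by polarization.\<close>

definition polar_covariance :: "(real \<Rightarrow> real) \<Rightarrow> real \<Rightarrow> real \<Rightarrow> real \<Rightarrow> real \<Rightarrow> real" where
  "polar_covariance \<sigma> p q u v = (\<sigma> \<bar>v - p\<bar> + \<sigma> \<bar>u - q\<bar> - \<sigma> \<bar>v - q\<bar> - \<sigma> \<bar>u - p\<bar>) / 2"

text \<open>The factor 2 is a variation budget for the function \<open>G\<close> of the proof: a
  fall of at most \<open>\<sigma> (q - p) / 2\<close> before \<open>p\<close>, a rise of
  \<open>\<sigma> (q - p)\<close> up to \<open>q\<close>, and a fall of at most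
  \<open>\<sigma> (q - p) / 2\<close> afterwards.\<close>

lemma sum_polar_covariance_le:
  fixes \<sigma> :: "real \<Rightarrow> real"
  assumes mono: "\<And>x y. 0 \<le> x \<Longrightarrow> x \<le> y \<Longrightarrow> \<sigma> x \<le> \<sigma> y"
    and incr: "\<And>x y a. 0 \<le> x \<Longrightarrow> x \<le> y \<Longrightarrow> 0 \<le> a \<Longrightarrow> \<sigma> (y + a) - \<sigma> y \<le> \<sigma> (x + a) - \<sigma> x"
    and zero: "\<sigma> 0 = 0"
    and "p \<le> q" "s \<le> t" and div: "\<P> division_of {s..t}"
  shows "(\<Sum>J\<in>\<P>. \<bar>polar_covariance \<sigma> p q (Inf J) (Sup J)\<bar>) \<le> 2 * \<sigma> (q - p)"
proof -
  text \<open>The covariance of the increment over \<open>{p..q}\<close> with the one over \<open>{u..v}\<close> is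
    \<open>G v - G u\<close>; \<open>G\<close> decreases up to \<open>p\<close>, increases on \<open>{p..q}\<close> and decreases after \<open>q\<close>, and
    \<open>H\<close> is its variation function.\<close>
  define G where "G v = (\<sigma> \<bar>v - p\<bar> - \<sigma> \<bar>v - q\<bar>) / 2" for v
  define H where "H v = (if v \<le> p then - G v else if v \<le> q then G v + \<sigma> (q - p)
      else 2 * \<sigma> (q - p) - G v)" for v
  \<comment> \<open>With these values the branches of \<open>H\<close> agree at \<open>p\<close> and
    \<open>q\<close>, where \<open>H\<close> is one half and three halves of
    \<open>\<sigma> (q - p)\<close>.\<close>
  have Gp: "G p = - \<sigma> (q - p) / 2" and Gq: "G q = \<sigma> (q - p) / 2"
    using \<open>p \<le> q\<close> zero by (auto simp: G_def)
  have left: "G v \<le> G u" if "u \<le> v" "v \<le> p" for u v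
    using incr[of "p - v" "p - u" "q - p"] that \<open>p \<le> q\<close> by (simp add: G_def)
  have mid: "G u \<le> G v" if "p \<le> u" "u \<le> v" "v \<le> q" for u v
    using mono[of "u - p" "v - p"] mono[of "q - v" "q - u"] that by (simp add: G_def)
  have right: "G v \<le> G u" if "q \<le> u" "u \<le> v" for u v
    using incr[of "u - q" "v - q" "q - p"] that \<open>p \<le> q\<close> by (simp add: G_def)
  have le: "\<bar>G v - G u\<bar> \<le> H v - H u" if "u \<le> v" for u v
    using that \<open>p \<le> q\<close> left[of u v] left[of u p] mid[of u v] mid[of p v] mid[of u q] mid[of p q]
      right[of u v] right[of q v] Gp Gq
    unfolding H_def by (auto simp: abs_le_iff split: if_splits)
  have H_bounds: "0 \<le> H v" "H v \<le> 2 * \<sigma> (q - p)" for v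
  proof -
    have "0 \<le> \<sigma> (q - p)" using mono[of 0 "q - p"] zero \<open>p \<le> q\<close> by simp
    \<comment> \<open>The sign of \<open>G\<close> on each outer ray caps the variation
      there.\<close>
    moreover have "G v \<le> 0" if "v \<le> p"
      using mono[of "p - v" "q - v"] that \<open>p \<le> q\<close> by (simp add: G_def)
    moreover have "0 \<le> G v" if "q \<le> v"
      using mono[of "v - q" "v - p"] that \<open>p \<le> q\<close> by (simp add: G_def)
    ultimately show "0 \<le> H v" "H v \<le> 2 * \<sigma> (q - p)"
      using \<open>p \<le> q\<close> left[of v p] mid[of p v] mid[of v q] right[of q v] Gp Gq
      unfolding H_def by (auto split: if_splits)
  qed
  have "(\<Sum>J\<in>\<P>. \<bar>polar_covariance \<sigma> p q (Inf J) (Sup J)\<bar>)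
      \<le> (\<Sum>J\<in>\<P>. H (Sup J) - H (Inf J))"
  proof (rule sum_mono)
    fix J assume "J \<in> \<P>"
    then obtain u v where "J = {u..v}" "u \<le> v"
      using division_ofD(3,4)[OF div] by (metis atLeastatMost_empty_iff cbox_interval)
    then show "\<bar>polar_covariance \<sigma> p q (Inf J) (Sup J)\<bar> \<le> H (Sup J) - H (Inf J)"
      using le[of u v] by (simp add: polar_covariance_def G_def diff_divide_distrib add_divide_distrib algebra_simps)
  qed
  also have "\<dots> = H t - H s"
    using sum_division_of_increments[OF \<open>s \<le> t\<close> div] .
  also have "\<dots> \<le> 2 * \<sigma> (q - p)"
    using H_bounds[of t] H_bounds[of s] by simp
  finally show ?thesis .
qed

section \<open>Joint measurability and second moments of averaged processes\<close>

text \<open>Time is rounded down to a grid of mesh \<open>1 / Suc n\<close>; path continuity makes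
  the rounded processes converge pointwise.\<close>

lemma borel_measurable_pair_continuous:
  fixes f :: "real \<Rightarrow> 'a \<Rightarrow> real"
  assumes meas[measurable]: "\<And>r. f r \<in> borel_measurable M"
    and cont: "\<And>x. x \<in> space M \<Longrightarrow> continuous_on UNIV (\<lambda>r. f r x)"
  shows "(\<lambda>(r, x). f r x) \<in> borel_measurable (borel \<Otimes>\<^sub>M M)"
proof (rule borel_measurable_LIMSEQ_real)
  fix n :: nat
  \<comment> \<open>Rounded time has countably many values, so measurability at each fixed time
    suffices.\<close>
  have "(\<lambda>z. (\<lambda>k z. f (real_of_int k / real (Suc n)) (snd z)) \<lfloor>real (Suc n) * fst z\<rfloor> z)
      \<in> borel_measurable (borel \<Otimes>\<^sub>M M)"
    by (rule measurable_compose_countable) measurable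
  then show "(\<lambda>z. f (real_of_int \<lfloor>real (Suc n) * fst z\<rfloor> / real (Suc n)) (snd z))
      \<in> borel_measurable (borel \<Otimes>\<^sub>M M)" by simp
next
  fix z assume "z \<in> space (borel \<Otimes>\<^sub>M M :: (real \<times> 'a) measure)"
  then obtain r x where z: "z = (r, x)" "x \<in> space M" by (auto simp: space_pair_measure)
  have "(\<lambda>n. real_of_int \<lfloor>real (Suc n) * r\<rfloor> / real (Suc n)) \<longlonglongrightarrow> r"
  proof (rule tendsto_sandwich)
    show "\<forall>\<^sub>F n in sequentially. r - 1 / real (Suc n) \<le> real_of_int \<lfloor>real (Suc n) * r\<rfloor> / real (Suc n)"
    proof (intro always_eventually allI)
      fix n
      have "(real (Suc n) * r - 1) / real (Suc n) \<le> real_of_int \<lfloor>real (Suc n) * r\<rfloor> / real (Suc n)"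
        by (rule divide_right_mono) linarith+
      then show "r - 1 / real (Suc n) \<le> real_of_int \<lfloor>real (Suc n) * r\<rfloor> / real (Suc n)"
        by (simp add: diff_divide_distrib del: of_nat_Suc)
    qed
    show "\<forall>\<^sub>F n in sequentially. real_of_int \<lfloor>real (Suc n) * r\<rfloor> / real (Suc n) \<le> r"
      by (intro always_eventually allI) (simp add: field_simps del: of_nat_Suc)
    show "(\<lambda>n. r - 1 / real (Suc n)) \<longlonglongrightarrow> r"
      using tendsto_diff[OF tendsto_const LIMSEQ_inverse_real_of_nat, of r]
      by (simp add: inverse_eq_divide)
  qed simp
  then have "(\<lambda>n. f (real_of_int \<lfloor>real (Suc n) * r\<rfloor> / real (Suc n)) x) \<longlonglongrightarrow> f r x"
    using cont[OF z(2)]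
    by (intro isCont_tendsto_compose[of r "\<lambda>r. f r x"]) (simp add: continuous_on_eq_continuous_at)
  then show "(\<lambda>n. f (real_of_int \<lfloor>real (Suc n) * fst z\<rfloor> / real (Suc n)) (snd z))
      \<longlonglongrightarrow> (case z of (r, x) \<Rightarrow> f r x)" by (simp add: z)
qed

text \<open>Follows from \<open>2 * \<bar>a * b\<bar> \<le> a\<^sup>2 + b\<^sup>2\<close>; a common
  bound on both second moments thus carries over to the product.\<close>

lemma integrable_mult_of_squares:
  fixes f g :: "'a \<Rightarrow> real"
  assumes [measurable]: "f \<in> borel_measurable M" "g \<in> borel_measurable M"
    and "integrable M (\<lambda>x. (f x)\<^sup>2)" "integrable M (\<lambda>x. (g x)\<^sup>2)"
  shows "integrable M (\<lambda>x. f x * g x)"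
    and "(\<integral>x. \<bar>f x * g x\<bar> \<partial>M) \<le> ((\<integral>x. (f x)\<^sup>2 \<partial>M) + (\<integral>x. (g x)\<^sup>2 \<partial>M)) / 2"
proof -
  have *: "\<bar>a * b\<bar> \<le> (a\<^sup>2 + b\<^sup>2) / 2" for a b :: real
    using sum_squares_bound[of "\<bar>a\<bar>" "\<bar>b\<bar>"] by (simp add: abs_mult)
  have i: "integrable M (\<lambda>x. ((f x)\<^sup>2 + (g x)\<^sup>2) / 2)" using assms by simp
  show fg: "integrable M (\<lambda>x. f x * g x)"
    by (rule Bochner_Integration.integrable_bound[OF i]) (use * in \<open>auto intro!: order_trans[OF *]\<close>)
  have "(\<integral>x. \<bar>f x * g x\<bar> \<partial>M) \<le> (\<integral>x. ((f x)\<^sup>2 + (g x)\<^sup>2) / 2 \<partial>M)"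
    using fg i * by (intro integral_mono) auto
  then show "(\<integral>x. \<bar>f x * g x\<bar> \<partial>M) \<le> ((\<integral>x. (f x)\<^sup>2 \<partial>M) + (\<integral>x. (g x)\<^sup>2 \<partial>M)) / 2"
    using assms by simp
qed

text \<open>The squared integral is an integral over \<open>N \<Otimes>\<^sub>M N\<close>, exchanged
  with \<open>M\<close> by Fubini; finiteness of \<open>N\<close> and the uniform bound
  \<open>C\<close> give integrability.\<close>

lemma second_moment_integral:
  fixes Z :: "'b \<Rightarrow> 'a \<Rightarrow> real"
  assumes N: "finite_measure N" and M: "sigma_finite_measure M"
    and Z[measurable]: "(\<lambda>(r, x). Z r x) \<in> borel_measurable (N \<Otimes>\<^sub>M M)"
    and int: "\<And>r. r \<in> space N \<Longrightarrow> integrable M (\<lambda>x. (Z r x)\<^sup>2)"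
    and le: "\<And>r. r \<in> space N \<Longrightarrow> (\<integral>x. (Z r x)\<^sup>2 \<partial>M) \<le> C"
  shows "integrable M (\<lambda>x. (\<integral>r. Z r x \<partial>N)\<^sup>2)"
    and "(\<integral>x. (\<integral>r. Z r x \<partial>N)\<^sup>2 \<partial>M) = (\<integral>r. \<integral>r'. (\<integral>x. Z r x * Z r' x \<partial>M) \<partial>N \<partial>N)"
proof -
  interpret N: finite_measure N by fact
  interpret M: sigma_finite_measure M by fact
  interpret NN: pair_sigma_finite N N ..
  interpret L: finite_measure "N \<Otimes>\<^sub>M N" by (rule finite_measure_pair_measure[OF N N])
  interpret LM: pair_sigma_finite "N \<Otimes>\<^sub>M N" M ..
  let ?f = "\<lambda>p x. Z (fst p) x * Z (snd p) x"
  have Zr[measurable]: "Z r \<in> borel_measurable M" if "r \<in> space N" for r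
    using that by measurable
  have f: "integrable ((N \<Otimes>\<^sub>M N) \<Otimes>\<^sub>M M) (\<lambda>(p, x). ?f p x)"
  proof (rule LM.Fubini_integrable)
    show "(\<lambda>(p, x). ?f p x) \<in> borel_measurable ((N \<Otimes>\<^sub>M N) \<Otimes>\<^sub>M M)" by measurable
    show "integrable (N \<Otimes>\<^sub>M N) (\<lambda>p. \<integral>x. norm (case (p, x) of (p, x) \<Rightarrow> ?f p x) \<partial>M)"
    proof (rule L.integrable_const_bound[where B = C])
      show "AE p in N \<Otimes>\<^sub>M N. norm (\<integral>x. norm (case (p, x) of (p, x) \<Rightarrow> ?f p x) \<partial>M) \<le> C"
      proof (rule AE_I2)
        fix p assume "p \<in> space (N \<Otimes>\<^sub>M N)"
        then have p: "fst p \<in> space N" "snd p \<in> space N" by (auto simp: space_pair_measure)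
        have "(\<integral>x. \<bar>?f p x\<bar> \<partial>M) \<le> C"
          using integrable_mult_of_squares(2)[OF Zr[OF p(1)] Zr[OF p(2)] int[OF p(1)] int[OF p(2)]]
            le[OF p(1)] le[OF p(2)] by simp
        then show "norm (\<integral>x. norm (case (p, x) of (p, x) \<Rightarrow> ?f p x) \<partial>M) \<le> C" by simp
      qed
    qed measurable
    show "AE p in N \<Otimes>\<^sub>M N. integrable M (\<lambda>x. case (p, x) of (p, x) \<Rightarrow> ?f p x)"
      by (rule AE_I2) (auto simp: space_pair_measure intro!: integrable_mult_of_squares int Zr)
  qed
  \<comment> \<open>Factoring the product integral needs integrability in \<open>p\<close> at fixed
    \<open>x\<close>, which Fubini grants only for almost every \<open>x\<close>.\<close>
  have "(\<integral>r. Z r x \<partial>N)\<^sup>2 = (\<integral>p. ?f p x \<partial>(N \<Otimes>\<^sub>M N))"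
    if "integrable (N \<Otimes>\<^sub>M N) (\<lambda>p. ?f p x)" for x
    using NN.integral_fst'[OF that] by (simp add: power2_eq_square)
  then have eq: "AE x in M. (\<integral>p. ?f p x \<partial>(N \<Otimes>\<^sub>M N)) = (\<integral>r. Z r x \<partial>N)\<^sup>2"
    using LM.AE_integrable_snd[OF f] by auto
  have [measurable]: "(\<lambda>x. (\<integral>r. Z r x \<partial>N)\<^sup>2) \<in> borel_measurable M" by measurable
  show "integrable M (\<lambda>x. (\<integral>r. Z r x \<partial>N)\<^sup>2)"
    by (rule integrable_cong_AE_imp[OF LM.integrable_snd[OF f]]) (use eq in auto)
  have "(\<integral>x. (\<integral>r. Z r x \<partial>N)\<^sup>2 \<partial>M) = (\<integral>x. (\<integral>p. ?f p x \<partial>(N \<Otimes>\<^sub>M N)) \<partial>M)"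
    by (rule integral_cong_AE) (use eq in \<open>auto intro!: borel_measurable_integrable[OF LM.integrable_snd[OF f]]\<close>)
  also have "\<dots> = (\<integral>p. (\<integral>x. ?f p x \<partial>M) \<partial>(N \<Otimes>\<^sub>M N))"
    by (rule LM.Fubini_integral[OF f])
  also have "\<dots> = (\<integral>r. \<integral>r'. (\<integral>x. Z r x * Z r' x \<partial>M) \<partial>N \<partial>N)"
    using NN.integral_fst'[OF LM.integrable_fst[OF f]] by simp
  finally show "(\<integral>x. (\<integral>r. Z r x \<partial>N)\<^sup>2 \<partial>M) = (\<integral>r. \<integral>r'. (\<integral>x. Z r x * Z r' x \<partial>M) \<partial>N \<partial>N)" .
qed

section \<open>Covariances from variances, and Brownian increments\<close>

text \<open>The product is a signed combination of four squared increments. Used with the identity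
  for Brownian motion and with \<open>smoothing_variance \<delta>\<close> for the smoothing
  error.\<close>

lemma polar_covariance_eq_integral:
  fixes X :: "real \<Rightarrow> 'a \<Rightarrow> real"
  assumes int: "\<And>s t. integrable M (\<lambda>x. (X t x - X s x)\<^sup>2)"
    and var: "\<And>s t. (\<integral>x. (X t x - X s x)\<^sup>2 \<partial>M) = \<sigma> \<bar>t - s\<bar>"
  shows "integrable M (\<lambda>x. (X q x - X p x) * (X v x - X u x))"
    and "(\<integral>x. (X q x - X p x) * (X v x - X u x) \<partial>M) = polar_covariance \<sigma> p q u v"
proof -
  have *: "(X q x - X p x) * (X v x - X u x) = ((X v x - X p x)\<^sup>2 + (X u x - X q x)\<^sup>2
      - (X v x - X q x)\<^sup>2 - (X u x - X p x)\<^sup>2) / 2" for x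
    by (simp add: power2_eq_square algebra_simps)
  show "integrable M (\<lambda>x. (X q x - X p x) * (X v x - X u x))"
    unfolding * using int by simp
  show "(\<integral>x. (X q x - X p x) * (X v x - X u x) \<partial>M) = polar_covariance \<sigma> p q u v"
    unfolding * polar_covariance_def using int by (simp add: var)
qed

lemma real_brownian_motion_increment:
  assumes "real_brownian_motion M B"
  shows "integrable M (\<lambda>x. (B t x - B s x)\<^sup>2)"
    and "(\<integral>x. (B t x - B s x)\<^sup>2 \<partial>M) = \<bar>t - s\<bar>"
proof -
  interpret prob_space M using assms by (simp add: real_brownian_motion_def)
  have *: "integrable M (\<lambda>x. (B t x - B s x)\<^sup>2) \<and> (\<integral>x. (B t x - B s x)\<^sup>2 \<partial>M) = t - s"
    if "s < t" for s t
  proof -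
    have D: "distributed M lborel (\<lambda>x. B t x - B s x) (\<lambda>y. ennreal (normal_density 0 (sqrt (t - s)) y))"
      using assms that by (simp add: real_brownian_motion_def)
    have "has_bochner_integral lborel (\<lambda>y. normal_density 0 (sqrt v) y * y\<^sup>2) v" if "0 < v" for v
      using normal_moment_even[of "sqrt v" 0 1] that by (simp add: eval_nat_numeral)
    then have m: "has_bochner_integral lborel (\<lambda>y. normal_density 0 (sqrt (t - s)) y * y\<^sup>2) (t - s)"
      using that by simp
    show ?thesis
      using distributed_integrable[OF D, of "\<lambda>y. y\<^sup>2"] distributed_integral[OF D, of "\<lambda>y. y\<^sup>2"] m
      by (simp add: has_bochner_integral_iff)
  qed
  consider "s < t" | "s = t" | "t < s" by linarith
  then have "integrable M (\<lambda>x. (B t x - B s x)\<^sup>2) \<and> (\<integral>x. (B t x - B s x)\<^sup>2 \<partial>M) = \<bar>t - s\<bar>"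
  proof cases
    case 3
    then show ?thesis using *[of t s] by (simp add: power2_commute[of "B t _"])
  qed (use *[of s t] in auto)
  then show "integrable M (\<lambda>x. (B t x - B s x)\<^sup>2)"
    and "(\<integral>x. (B t x - B s x)\<^sup>2 \<partial>M) = \<bar>t - s\<bar>" by auto
qed

section \<open>The smoothing error as an average, and the double integral of covariances\<close>

lemma integral_FTC_restrict_Icc:
  fixes f F :: "real \<Rightarrow> real"
  assumes "a \<le> b"
    and "\<And>x. a \<le> x \<Longrightarrow> x \<le> b \<Longrightarrow> (F has_field_derivative f x) (at x)"
    and "continuous_on {a..b} f"
  shows "(\<integral>x. f x \<partial>restrict_space lborel {a..b}) = F b - F a"
proof -
  have "(\<integral>x. f x \<partial>restrict_space lborel {a..b}) = (\<integral>x. indicator {a..b} x *\<^sub>R f x \<partial>lborel)"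
    by (subst integral_restrict_space) auto
  also have "\<dots> = F b - F a"
    using assms by (intro integral_FTC_atLeastAtMost)
      (auto simp flip: has_real_derivative_iff_has_vector_derivative intro: has_field_derivative_at_within)
  finally show ?thesis .
qed

text \<open>Through an antiderivative \<open>F\<close> of the path both sides become the same
  combination of values of \<open>F\<close>; the term \<open>w t\<close> enters the average as a
  constant.\<close>

lemma smoothing_error_diff:
  fixes w :: "real \<Rightarrow> real ^ 'm"
  assumes cont: "continuous_on UNIV w" and "0 < \<delta>"
  shows "smoothing_error \<delta> t w $ i - smoothing_error \<delta> s w $ i
    = (\<integral>r. (w (t + r) $ i - w t $ i) - (w (s + r) $ i - w s $ i) \<partial>restrict_space lborel {0..\<delta>}) / \<delta>"
proof -
  have "\<exists>F. \<forall>x::real. - \<infinity> < ereal x \<longrightarrow> ereal x < \<infinity> \<longrightarrow> (F has_vector_derivative w x) (at x)"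
    using cont by (intro einterval_antiderivative) (auto simp: continuous_on_eq_continuous_at)
  then obtain F where F: "\<And>x. (F has_vector_derivative w x) (at x)" by auto
  have Fshift: "((\<lambda>x. F (c + x)) has_vector_derivative w (c + x)) (at x)" for c x
  proof -
    have "((\<lambda>x. c + x) has_vector_derivative 1) (at x)"
      by (auto intro!: derivative_eq_intros)
    from vector_diff_chain_at[OF this F] show ?thesis by (simp add: o_def)
  qed
  have wshift: "continuous_on A (\<lambda>x. w (c + x))" for A c
    by (rule continuous_on_compose2[OF cont]) (auto intro!: continuous_intros)
  \<comment> \<open>The oriented integral covers negative \<open>t\<close> as well; the bracket
    belonging to 0 is independent of \<open>t\<close> and cancels in the increment.\<close>
  have "(LBINT r=0..t. w (\<delta> + r) - w r) = (F (\<delta> + t) - F t) - (F (\<delta> + 0) - F 0)" for t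
    unfolding zero_ereal_def
    by (rule interval_integral_FTC_finite)
      (auto intro!: continuous_intros wshift continuous_on_subset[OF cont]
          has_vector_derivative_diff has_vector_derivative_at_within[OF F]
          has_vector_derivative_at_within[OF Fshift])
  then have e: "smoothing_error \<delta> t w $ i
      = ((F (\<delta> + t) $ i - F t $ i) - (F \<delta> $ i - F 0 $ i)) / \<delta> - w t $ i" for t
    by (simp add: smoothing_error_def smoothed_path_def)
  have Fi: "((\<lambda>x. F (c + x) $ i) has_field_derivative w (c + x) $ i) (at x)" for c x
    using bounded_linear.has_vector_derivative[OF bounded_linear_vec_nth Fshift]
    by (simp add: has_real_derivative_iff_has_vector_derivative)
  have I: "(\<integral>r. (w (t + r) $ i - w t $ i) - (w (s + r) $ i - w s $ i) \<partial>restrict_space lborel {0..\<delta>})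
      = ((F (t + \<delta>) $ i - \<delta> * w t $ i) - (F (s + \<delta>) $ i - \<delta> * w s $ i))
        - ((F (t + 0) $ i - 0 * w t $ i) - (F (s + 0) $ i - 0 * w s $ i))"
    using \<open>0 < \<delta>\<close>
    by (intro integral_FTC_restrict_Icc) (auto intro!: derivative_eq_intros Fi continuous_intros wshift)
  show ?thesis
    unfolding e I using \<open>0 < \<delta>\<close> by (simp add: field_simps)
qed

text \<open>The integrand is the covariance of the second order increments
  \<open>(B (u + r) - B u) - (B r - B 0)\<close> and \<open>(B (u + r') - B u) - (B r' - B 0)\<close> of a Brownian motion,
  with the minima \<open>min r r'\<close> written through positive parts, whose iterated antiderivatives
  are powers of positive parts.\<close>

lemma double_integral_smoothing_variance:
  assumes "0 < \<delta>" "0 \<le> u"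
  defines "N \<equiv> restrict_space lborel {0..\<delta>}"
  shows "(\<integral>r. \<integral>r'. 2 * (max 0 r' - max 0 (r' - r)) - (max 0 (r' - u) - max 0 (r' - u - r))
      - (max 0 (r - u) - max 0 (r - u - r')) \<partial>N \<partial>N) = \<delta>\<^sup>2 * smoothing_variance \<delta> u"
proof -
  define Q where "Q x = (max 0 x)\<^sup>2 / 2" for x :: real
  define R where "R x = max 0 x ^ 3 / 6" for x :: real
  have contQ: "continuous_on A (\<lambda>x. Q (f x))" if "continuous_on A f" for A and f :: "real \<Rightarrow> real"
    unfolding Q_def by (intro continuous_intros that) simp
  have "(Q has_field_derivative max 0 x) (at x)" for x
    unfolding Q_def using DERIV_cdivide[OF has_field_derivative_max_0_power[of 0 x], of 2]
    by (simp add: numeral_2_eq_2)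
  from DERIV_chain2[OF this]
  have dQ: "((\<lambda>x. Q (f x)) has_field_derivative max 0 (f x) * f') (at x)"
    if "(f has_field_derivative f') (at x)" for f f' x using that by blast
  have "(R has_field_derivative Q x) (at x)" for x
    unfolding Q_def R_def using DERIV_cdivide[OF has_field_derivative_max_0_power[of 1 x], of 6]
    by (simp add: numeral_2_eq_2 numeral_3_eq_3)
  from DERIV_chain2[OF this]
  have dR: "((\<lambda>x. R (f x)) has_field_derivative Q (f x) * f') (at x)"
    if "(f has_field_derivative f') (at x)" for f f' x using that by blast
  have Q0: "Q x = 0" and R0: "R x = 0" if "x \<le> 0" for x
    using that by (auto simp: Q_def R_def)
  have inner: "(\<integral>r'. 2 * (max 0 r' - max 0 (r' - r)) - (max 0 (r' - u) - max 0 (r' - u - r))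
      - (max 0 (r - u) - max 0 (r - u - r')) \<partial>N)
    = 2 * (Q \<delta> - Q (\<delta> - r)) - (Q (\<delta> - u) - Q (\<delta> - u - r)) - (\<delta> * max 0 (r - u) - Q (r - u))"
    (is "?I r = ?J r") if r: "0 \<le> r" "r \<le> \<delta>" for r
  proof -
    let ?F = "\<lambda>r'. 2 * (Q r' - Q (r' - r)) - (Q (r' - u) - Q (r' - u - r))
      - (r' * max 0 (r - u) + Q (r - u - r'))"
    have "?I r = ?F \<delta> - ?F 0"
      unfolding N_def
    proof (rule integral_FTC_restrict_Icc)
      show "(?F has_field_derivative 2 * (max 0 x - max 0 (x - r)) - (max 0 (x - u) - max 0 (x - u - r))
        - (max 0 (r - u) - max 0 (r - u - x))) (at x)" for x
        by (rule derivative_eq_intros dQ refl)+ simp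
    qed (use assms in \<open>auto intro!: continuous_intros\<close>)
    \<comment> \<open>At the lower endpoint only \<open>Q (r - u)\<close> survives; at the upper one
      \<open>Q (r - u - \<delta>)\<close> vanishes because \<open>r \<le> \<delta>\<close>.\<close>
    also have "\<dots> = ?J r" using r assms by (simp add: Q0)
    finally show ?thesis .
  qed
  define q where "q = max 0 (\<delta> - u)"
  let ?F = "\<lambda>r. 2 * (r * Q \<delta> + R (\<delta> - r)) - (r * Q (\<delta> - u) + R (\<delta> - u - r))
      - (\<delta> * Q (r - u) - R (r - u))"
  have "(\<integral>r. ?I r \<partial>N) = (\<integral>r. ?J r \<partial>N)"
    using inner by (intro Bochner_Integration.integral_cong) (auto simp: N_def space_restrict_space)
  also have "\<dots> = ?F \<delta> - ?F 0"
    unfolding N_def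
  proof (rule integral_FTC_restrict_Icc)
    show "(?F has_field_derivative ?J x) (at x)" for x
      by (rule derivative_eq_intros dQ dR refl)+ simp
  qed (use assms in \<open>auto intro!: continuous_intros contQ\<close>)
  \<comment> \<open>The surviving boundary terms are \<open>2 * \<delta> * Q \<delta> - 2 * R
    \<delta> - 2 * \<delta> * Q (\<delta> - u) + 2 * R (\<delta> - u)\<close>.\<close>
  also have "\<dots> = \<delta>\<^sup>2 * smoothing_variance \<delta> u"
    using assms by (simp add: R0 Q0) (simp add: Q_def R_def smoothing_variance_def field_simps
        power2_eq_square power3_eq_cube flip: q_def)
  finally show ?thesis .
qed

section \<open>Variance of the increments of the smoothing error\<close>

lemma smoothed_increment_variance:
  assumes B: "real_brownian_motion M B" and "0 < \<delta>"
  defines "D \<equiv> \<lambda>s t x. (\<integral>r. (B (t + r) x - B t x) - (B (s + r) x - B s x)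
      \<partial>restrict_space lborel {0..\<delta>}) / \<delta>"
  shows "integrable M (\<lambda>x. (D s t x)\<^sup>2)"
    and "(\<integral>x. (D s t x)\<^sup>2 \<partial>M) = smoothing_variance \<delta> \<bar>t - s\<bar>"
proof -
  interpret prob_space M using B by (simp add: real_brownian_motion_def)
  define N where "N = restrict_space lborel {0..\<delta>}"
  have N: "finite_measure N"
    using \<open>0 < \<delta>\<close>
    by (intro finite_measureI) (simp add: N_def emeasure_restrict_space space_restrict_space)
  have cont: "continuous_on UNIV (\<lambda>r. B r x)" if "x \<in> space M" for x
    using B that by (simp add: real_brownian_motion_def)
  have [measurable]: "B r \<in> borel_measurable M" for r
    using B by (simp add: real_brownian_motion_def)
  note B_cov = polar_covariance_eq_integral[of M B "\<lambda>u. u",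
      OF real_brownian_motion_increment[OF B]]
  have *: "integrable M (\<lambda>x. (D s t x)\<^sup>2) \<and>
      (\<integral>x. (D s t x)\<^sup>2 \<partial>M) = smoothing_variance \<delta> \<bar>t - s\<bar>" if "s \<le> t" for s t
  proof -
    define u where "u = t - s"
    define Z where "Z r x = (B (t + r) x - B t x) - (B (s + r) x - B s x)" for r x
    have ZZ: "Z r x * Z r' x =
        (B (t + r) x - B t x) * (B (t + r') x - B t x) - (B (t + r) x - B t x) * (B (s + r') x - B s x)
        - (B (s + r) x - B s x) * (B (t + r') x - B t x) + (B (s + r) x - B s x) * (B (s + r') x - B s x)"
      for r r' x by (simp add: Z_def algebra_simps)
    have Z_int: "integrable M (\<lambda>x. (Z r x)\<^sup>2)" for r
      unfolding power2_eq_square ZZ using B_cov(1) by simp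
    have Z_cov: "(\<integral>x. Z r x * Z r' x \<partial>M)
      = 2 * (max 0 r' - max 0 (r' - r)) - (max 0 (r' - u) - max 0 (r' - u - r))
      - (max 0 (r - u) - max 0 (r - u - r'))" if "0 \<le> r" "0 \<le> r'" for r r'
    proof -
      have "(\<integral>x. Z r x * Z r' x \<partial>M) =
          polar_covariance (\<lambda>u. u) t (t + r) t (t + r') - polar_covariance (\<lambda>u. u) t (t + r) s (s + r')
        - polar_covariance (\<lambda>u. u) s (s + r) t (t + r') + polar_covariance (\<lambda>u. u) s (s + r) s (s + r')"
        unfolding ZZ using B_cov by simp
      also have "\<dots> = 2 * (max 0 r' - max 0 (r' - r)) - (max 0 (r' - u) - max 0 (r' - u - r))
          - (max 0 (r - u) - max 0 (r - u - r'))"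
      proof -
        \<comment> \<open>Each Brownian covariance is the length of the overlap of its two time
          intervals; for the mixed ones the formulas rely on \<open>s \<le> t\<close>.\<close>
        have "polar_covariance (\<lambda>u. u) t (t + r) t (t + r') = max 0 r' - max 0 (r' - r)"
          "polar_covariance (\<lambda>u. u) s (s + r) s (s + r') = max 0 r' - max 0 (r' - r)"
          "polar_covariance (\<lambda>u. u) t (t + r) s (s + r') = max 0 (r' - u) - max 0 (r' - u - r)"
          "polar_covariance (\<lambda>u. u) s (s + r) t (t + r') = max 0 (r - u) - max 0 (r - u - r')"
          using that \<open>s \<le> t\<close> unfolding polar_covariance_def u_def
          by (auto simp: max_def abs_if field_simps)
        then show ?thesis by simp
      qed
      finally show ?thesis .
    qed
    \<comment> \<open>On the diagonal the two equal increments contribute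
      \<open>2 * r \<le> 2 * \<delta>\<close>, and the mixed overlaps are subtracted.\<close>
    have Z_var: "(\<integral>x. (Z r x)\<^sup>2 \<partial>M) \<le> 2 * \<delta>" if "r \<in> space N" for r
      using that Z_cov[of r r] \<open>s \<le> t\<close>
      by (auto simp: N_def space_restrict_space power2_eq_square u_def max_def)
    have "(\<lambda>(r, x). Z r x) \<in> borel_measurable (borel \<Otimes>\<^sub>M M)"
      unfolding Z_def
      by (rule borel_measurable_pair_continuous)
        (auto intro!: continuous_intros continuous_on_compose2[OF cont])
    moreover have "(\<lambda>z. (fst z, snd z)) \<in> measurable (N \<Otimes>\<^sub>M M) (borel \<Otimes>\<^sub>M M)"
      unfolding N_def
      by (intro measurable_Pair measurable_compose[OF measurable_fst] measurable_restrict_space1) auto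
    ultimately have Z_meas: "(\<lambda>(r, x). Z r x) \<in> borel_measurable (N \<Otimes>\<^sub>M M)"
      using measurable_compose by fastforce
    have Z: "integrable M (\<lambda>x. (\<integral>r. Z r x \<partial>N)\<^sup>2)"
      "(\<integral>x. (\<integral>r. Z r x \<partial>N)\<^sup>2 \<partial>M) = (\<integral>r. \<integral>r'. (\<integral>x. Z r x * Z r' x \<partial>M) \<partial>N \<partial>N)"
      by (rule second_moment_integral[OF N sigma_finite_measure_axioms Z_meas]; use Z_int Z_var in blast)+
    have D: "(D s t x)\<^sup>2 = (\<integral>r. Z r x \<partial>N)\<^sup>2 / \<delta>\<^sup>2" for x
      by (simp add: D_def Z_def N_def power_divide)
    have "(\<integral>x. (\<integral>r. Z r x \<partial>N)\<^sup>2 \<partial>M) = (\<integral>r. \<integral>r'. 2 * (max 0 r' - max 0 (r' - r))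
        - (max 0 (r' - u) - max 0 (r' - u - r)) - (max 0 (r - u) - max 0 (r - u - r')) \<partial>N \<partial>N)"
      unfolding Z(2)
      by (intro Bochner_Integration.integral_cong refl Z_cov) (auto simp: N_def space_restrict_space)
    also have "\<dots> = \<delta>\<^sup>2 * smoothing_variance \<delta> u"
      unfolding N_def using \<open>0 < \<delta>\<close> \<open>s \<le> t\<close>
      by (intro double_integral_smoothing_variance) (auto simp: u_def)
    finally show ?thesis
      using Z(1) \<open>0 < \<delta>\<close> \<open>s \<le> t\<close> unfolding D by (simp add: u_def)
  qed
  \<comment> \<open>Swapping \<open>s\<close> and \<open>t\<close> only flips the sign, which
    reduces the claim to \<open>s \<le> t\<close>.\<close>
  have "(D s t x)\<^sup>2 = (D t s x)\<^sup>2" for x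
  proof -
    have "D s t x = - D t s x"
      unfolding D_def minus_divide_left by (subst Bochner_Integration.integral_minus[symmetric]) simp
    then show ?thesis by simp
  qed
  then show "integrable M (\<lambda>x. (D s t x)\<^sup>2)"
    "(\<integral>x. (D s t x)\<^sup>2 \<partial>M) = smoothing_variance \<delta> \<bar>t - s\<bar>"
    using *[of s t] *[of t s] by (cases "s \<le> t"; simp add: abs_minus_commute)+
qed

section \<open>The variance bound and the covariance variation bound\<close>

theorem theorem10:
  fixes P :: "(real \<Rightarrow> real ^ 'm) measure" and \<delta> \<rho> :: real and i :: 'm
  assumes "wiener_measure P"
    and "0 < \<delta>" and "\<delta> \<le> 1"
    and "1 \<le> \<rho>" and "\<rho> < 2"
  defines "X \<equiv> \<lambda>t \<omega>. smoothing_error \<delta> t \<omega> $ i"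
    and "M \<equiv> ((2 powr (1 + \<rho>) + 1) / 3 powr (1 - \<rho>)) powr (1 / \<rho>)"
  shows "(\<forall>t u. 0 \<le> u \<longrightarrow>
            increment_variance P X t u \<le> \<delta> powr (1 - 1 / \<rho>) * u powr (1 / \<rho>)) \<and>
         (\<forall>s t. s \<le> t \<longrightarrow>
            covariance_variation \<rho> P X s t
              \<le> ennreal (\<delta> powr (1 - 1 / \<rho>) * M * \<bar>t - s\<bar> powr (1 / \<rho>)))"
proof -
  let ?V = "smoothing_variance \<delta>"
  have B: "real_brownian_motion P (\<lambda>t \<omega>. \<omega> t $ j)" for j
    using assms(1) by (simp add: wiener_measure_def brownian_motion_def)
  have cont: "continuous_on UNIV \<omega>" if "\<omega> \<in> space P" for \<omega>
    using continuous_on_vec_lambda[of UNIV "\<lambda>j t. \<omega> t $ j"] B that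
    by (simp add: real_brownian_motion_def)
  note inc = smoothed_increment_variance[OF B[of i] \<open>0 < \<delta>\<close>]
  have X: "X t \<omega> - X s \<omega> = (\<integral>r. (\<omega> (t + r) $ i - \<omega> t $ i) - (\<omega> (s + r) $ i - \<omega> s $ i)
      \<partial>restrict_space lborel {0..\<delta>}) / \<delta>" if "\<omega> \<in> space P" for s t \<omega>
    unfolding X_def by (rule smoothing_error_diff[OF cont[OF that] \<open>0 < \<delta>\<close>])
  have X_int: "integrable P (\<lambda>\<omega>. (X t \<omega> - X s \<omega>)\<^sup>2)" for s t
    using inc(1)[where s = s and t = t] by (simp add: X cong: Bochner_Integration.integrable_cong)
  have X_var: "(\<integral>\<omega>. (X t \<omega> - X s \<omega>)\<^sup>2 \<partial>P) = ?V \<bar>t - s\<bar>" for s t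
    using inc(2)[where s = s and t = t] by (simp add: X cong: Bochner_Integration.integral_cong)
  have V_le: "?V u \<le> \<delta> powr (1 - 1 / \<rho>) * u powr (1 / \<rho>)" if "0 \<le> u" for u
    using that assms by (intro le_powr_interpolate smoothing_variance_nonneg smoothing_variance_le) auto
  have "increment_variance P X t u \<le> \<delta> powr (1 - 1 / \<rho>) * u powr (1 / \<rho>)" if "0 \<le> u" for t u
    using V_le[OF that] that by (simp add: increment_variance_def X_var)
  moreover have "covariance_variation \<rho> P X s t
      \<le> ennreal (\<delta> powr (1 - 1 / \<rho>) * M * \<bar>t - s\<bar> powr (1 / \<rho>))" if "s \<le> t" for s t
  proof -
    \<comment> \<open>The power \<open>\<rho>\<close> turns \<open>u powr (1 / \<rho>)\<close> into
      \<open>u\<close>, so the bounds for the single intervals of a division add up exactly to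
      \<open>C\<close>.\<close>
    define C where "C = 2 powr \<rho> * (\<delta> powr (\<rho> - 1) * (t - s))"
    have V_powr: "(2 * ?V u) powr \<rho> \<le> 2 powr \<rho> * (\<delta> powr (\<rho> - 1) * u)" if "0 \<le> u" for u
    proof -
      have "(2 * ?V u) powr \<rho> \<le> (2 * (\<delta> powr (1 - 1 / \<rho>) * u powr (1 / \<rho>))) powr \<rho>"
        using that assms V_le[OF that] smoothing_variance_nonneg[of \<delta> u] by (intro powr_mono2) auto
      also have "\<dots> = 2 powr \<rho> * (\<delta> powr ((1 - 1 / \<rho>) * \<rho>) * u powr (1 / \<rho> * \<rho>))"
        by (simp add: powr_mult powr_powr)
      also have "\<dots> = 2 powr \<rho> * (\<delta> powr (\<rho> - 1) * u)"
        using that assms by (simp add: left_diff_distrib)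
      finally show ?thesis .
    qed
    have sum_le: "(\<Sum>I\<in>\<P>. \<Sum>J\<in>\<P>'. \<bar>increment_covariance P X I J\<bar> powr \<rho>) \<le> C"
      if \<P>: "\<P> division_of {s..t}" and \<P>': "\<P>' division_of {s..t}" for \<P> \<P>'
    proof -
      have "(\<Sum>I\<in>\<P>. \<Sum>J\<in>\<P>'. \<bar>increment_covariance P X I J\<bar> powr \<rho>)
          \<le> (\<Sum>I\<in>\<P>. 2 powr \<rho> * (\<delta> powr (\<rho> - 1) * (Sup I - Inf I)))"
      proof (rule sum_mono)
        fix I assume "I \<in> \<P>"
        then obtain p q where "I = {p..q}" "p \<le> q"
          using division_ofD(3,4)[OF \<P>] by (metis atLeastatMost_empty_iff cbox_interval)
        then have I: "Inf I = p" "Sup I = q" "p \<le> q" by auto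
        have "(\<Sum>J\<in>\<P>'. \<bar>increment_covariance P X I J\<bar> powr \<rho>)
            = (\<Sum>J\<in>\<P>'. \<bar>polar_covariance ?V p q (Inf J) (Sup J)\<bar> powr \<rho>)"
          unfolding increment_covariance_def I
          using polar_covariance_eq_integral(2)[of P X ?V, OF X_int X_var] by simp
        also have "\<dots> \<le> (\<Sum>J\<in>\<P>'. \<bar>polar_covariance ?V p q (Inf J) (Sup J)\<bar>) powr \<rho>"
          using assms division_of_finite[OF \<P>'] by (intro sum_powr_le_powr_sum) auto
        also have "\<dots> \<le> (2 * ?V (q - p)) powr \<rho>"
          using assms \<open>s \<le> t\<close> I(3) \<P>'
          by (intro powr_mono2 sum_polar_covariance_le sum_nonneg smoothing_variance_mono
              smoothing_variance_increment_antimono smoothing_variance_0) auto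
        also have "\<dots> \<le> 2 powr \<rho> * (\<delta> powr (\<rho> - 1) * (Sup I - Inf I))"
          using V_powr[of "q - p"] I by simp
        finally show "(\<Sum>J\<in>\<P>'. \<bar>increment_covariance P X I J\<bar> powr \<rho>)
            \<le> 2 powr \<rho> * (\<delta> powr (\<rho> - 1) * (Sup I - Inf I))" .
      qed
      also have "\<dots> = C"
        using sum_division_of_increments[OF \<open>s \<le> t\<close> \<P>, of "\<lambda>x. x"]
        by (simp add: C_def flip: sum_distrib_left)
      finally show ?thesis .
    qed
    define S where "S = (SUP (\<P>, \<P>') \<in> {\<P>. \<P> division_of {s..t}} \<times> {\<P>. \<P> division_of {s..t}}.
      ennreal (\<Sum>I\<in>\<P>. \<Sum>J\<in>\<P>'. \<bar>increment_covariance P X I J\<bar> powr \<rho>))"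
    have S: "S \<le> ennreal C"
      unfolding S_def by (rule SUP_least) (auto intro!: ennreal_leI sum_le)
    have "0 \<le> C" using that by (simp add: C_def)
    \<comment> \<open>The finite bound on \<open>S\<close> excludes the infinite branch of the
      definition.\<close>
    have "covariance_variation \<rho> P X s t = ennreal (enn2real S powr (1 / \<rho>))"
      using S unfolding covariance_variation_def S_def[symmetric] Let_def
      by (auto simp: top_unique)
    also have "\<dots> \<le> ennreal (C powr (1 / \<rho>))"
      using assms S enn2real_mono[OF S] \<open>0 \<le> C\<close> by (intro ennreal_leI powr_mono2) auto
    also have "C powr (1 / \<rho>) = \<delta> powr (1 - 1 / \<rho>) * (2 powr \<rho>) powr (1 / \<rho>) * \<bar>t - s\<bar> powr (1 / \<rho>)"
      using that assms by (simp add: C_def powr_mult powr_powr diff_divide_distrib)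
    also have "ennreal \<dots> \<le> ennreal (\<delta> powr (1 - 1 / \<rho>) * M * \<bar>t - s\<bar> powr (1 / \<rho>))"
    proof -
      \<comment> \<open>The constant obtained so far is 2; dividing by a number at most 1 only
        enlarges \<open>M\<close>, whose numerator already exceeds
        \<open>2 powr \<rho>\<close>.\<close>
      have "3 powr (1 - \<rho>) \<le> 1"
        using assms powr_mono[of "1 - \<rho>" 0 3] by simp
      then have "3 powr (1 - \<rho>) * 2 powr \<rho> \<le> 1 * 2 powr \<rho>"
        by (intro mult_right_mono) auto
      moreover have "2 powr \<rho> \<le> 2 powr (1 + \<rho>)" using assms by (intro powr_mono) auto
      ultimately have "3 powr (1 - \<rho>) * 2 powr \<rho> \<le> 2 powr (1 + \<rho>) + 1" by linarith
      then have "2 powr \<rho> \<le> (2 powr (1 + \<rho>) + 1) / 3 powr (1 - \<rho>)"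
        by (simp add: pos_le_divide_eq mult.commute)
      then have "(2 powr \<rho>) powr (1 / \<rho>) \<le> M"
        unfolding M_def using assms by (intro powr_mono2) auto
      then show ?thesis by (intro ennreal_leI mult_right_mono mult_left_mono) auto
    qed
    finally show ?thesis .
  qed
  ultimately show ?thesis by blast
qed

end
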